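(* Let $X$ and $Y$ be random variables with distribution functions $F=F_X$ and $G=F_Y$. Consider the sum $S=\mathbb{I}X+(1-\mathbb{I})Y$, where $\mathbb{I}$ is a Bernoulli distributed random variable with parameter $q\in(0,1)$ and where the components $X$ and $Y$ are independent of $\mathbb{I}$. Define $\alpha_*\in[0,1]$ by $$\alpha_*:=\inf\left\{\alpha\in(0,1)\ \middle|\ \exists\,\beta\in(0,1):\ q\alpha+(1-q)\beta=p\ \text{ and }\ F_X^{-1}(\alpha)\geq F_Y^{-1}(\beta)\right\}$$ and let $\beta_*=\frac{p-q\alpha_*}{1-q}\in[0,1]$. Then, for $p\in(0,1)$, $$s_p:=F_S^{-1}(p)=\max\left\{F_X^{-1}(\alpha_* ),\,F_Y^{-1}(\beta_* )\right\}.$$ This maximum can be computed explicitly by distinguishing four cases for $F$ and four cases for $G$. Cases for $F$: - Case 1: $F$ is continuous in $s_p$ and for all $z<s_p$, $F(z)<F(s_p)$. - Case 2: $F$ is continuous in $s_p$ and there exists $z<s_p$ with $F(z)=F(s_p)$. - Case 3: $F$ is discontinuous in $s_p$ and for all $z<s_p$, $F(z)<F(s_p^-)$. - Case 4: $F$ is discontinuous in $s_p$ and there exists $z<s_p$ with $F(z)=F(s_p^-)$. Cases for $G$: - Case a: $G$ is continuous in $s_p$ and for all $z<s_p$, $G(z)<G(s_p)$. - Case b: $G$ is continuous in $s_p$ and there exists $z<s_p$ with $G(z)=G(s_p)$. - Case c: $G$ is discontinuous in $s_p$ and for all $z<s_p$, $G(z)<G(s_p^-)$. - Case d: $G$ is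 discontinuous in $s_p$ and there exists $z<s_p$ with $G(z)=G(s_p^-)$. For the sixteen possible combinations the following holds: - (1a): $\alpha_*=F(s_p)$, $\beta_*=G(s_p)$, $s_p=F_X^{-1}(\alpha_* )=F_Y^{-1}(\beta_* )$. - (1b): $\alpha_*=F(s_p)$, $\beta_*=G(s_p)$, $s_p=F_X^{-1}(\alpha_* )>F_Y^{-1}(\beta_* )$. - (1c): $\alpha_*=F(s_p)$, $s_p=F_X^{-1}(\alpha_* )=F_Y^{-1}(\beta_* )$. - (1d): $\alpha_*=F(s_p)$; if $F_S(s_p^-)<p$, then $s_p=F_X^{-1}(\alpha_* )=F_Y^{-1}(\beta_* )$; if $F_S(s_p^-)=p$, then $s_p=F_X^{-1}(\alpha_* )>F_Y^{-1}(\beta_* )$. - (2a): $\alpha_*=F(s_p)$, $\beta_*=G(s_p)$, $s_p=F_Y^{-1}(\beta_* )>F_X^{-1}(\alpha_* )$. - (2b): impossible. - (2c): $\alpha_*=F(s_p)$, $s_p=F_Y^{-1}(\beta_* )>F_X^{-1}(\alpha_* )$. - (2d): $\alpha_*=F(s_p)$, $s_p=F_Y^{-1}(\beta_* )>F_X^{-1}(\alpha_* )$. - (3a): $\beta_*=G(s_p)$, $s_p=F_X^{-1}(\alpha_* )=F_Y^{-1}(\beta_* )$. - (3b): $\beta_*=G(s_p)$, $s_p=F_X^{-1}(\alpha_* )>F_Y^{-1}(\beta_* )$. - (3c): $s_p=F_X^{-1}(\alpha_* )=F_Y^{-1}(\beta_* )$. - (3d): if $F_S(s_p^-)<p$, then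 $s_p=F_X^{-1}(\alpha_* )=F_Y^{-1}(\beta_* )$; if $F_S(s_p^-)=p$, then $s_p=F_X^{-1}(\alpha_* )>F_Y^{-1}(\beta_* )$. - (4a): $\beta_*=G(s_p)$; if $F_S(s_p^-)<p$, then $s_p=F_Y^{-1}(\beta_* )=F_X^{-1}(\alpha_* )$; if $F_S(s_p^-)=p$, then $s_p=F_Y^{-1}(\beta_* )>F_X^{-1}(\alpha_* )$. - (4b): $\beta_*=G(s_p)$, $s_p=F_X^{-1}(\alpha_* )>F_Y^{-1}(\beta_* )$. - (4c): if $F_S(s_p^-)<p$, then $s_p=F_X^{-1}(\alpha_* )=F_Y^{-1}(\beta_* )$; if $F_S(s_p^-)=p$, then $s_p=F_Y^{-1}(\beta_* )>F_X^{-1}(\alpha_* )$. - (4d): impossible. In all cases, $\beta_*=\frac{p-q\alpha_*}{1-q}\leq G(s_p)$ and $\alpha_*=\frac{p-(1-q)\beta_*}{q}\geq F(s_p)$.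
   Context: For a random variable $Z$ with distribution function $F_Z(x)=P(Z\leq x)$, the quantile of $Z$ at level $u$ is $F_Z^{-1}(u)=\inf\{x\in\mathbb{R}\mid F_Z(x)\geq u\}$. With the conventions $\inf\emptyset=\infty$ and $\inf\mathbb{R}=-\infty$, it is defined for all $u\in[0,1]$. $F_S$ denotes the distribution function of $S$, so $F_S(x)=qF(x)+(1-q)G(x)$. For a distribution function $H$, $H(s_p^-)$ denotes the left limit of $H$ at $s_p$. The label (1a) means that $F$ is in Case 1 and $G$ is in Case a, and similarly for the other combinations. "Impossible" means the theorem asserts that the combination cannot occur.
   Formalization: An empty infimum in α* is read as min(1,p/q). (4d) can occur, with F_S(s_p^-)<p; in (4c),(4d) equality holds if qF(s_p^-)+(1-q)G(s_p)<p, else F_Y^{-1}(β* )>F_X^{-1}(α* ). The final α*≥F(s_p) becomes F(s_p^-)≤α*≤F(s_p). *)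

theory Defs
  imports "HOL-Probability.Probability"
begin

text \<open>In the complete lattice of extended reals the infimum of the empty set is \<open>\<infinity>\<close> and the
  infimum of the set of all reals is \<open>-\<infinity>\<close>, so this makes sense for every level in \<open>[0,1]\<close>.\<close>

definition quantile :: "(real \<Rightarrow> real) \<Rightarrow> real \<Rightarrow> ereal" where
  "quantile H u = (INF x\<in>{x. u \<le> H x}. ereal x)"

definition left_limit :: "(real \<Rightarrow> real) \<Rightarrow> real \<Rightarrow> real" where
  "left_limit H s = Lim (at_left s) H"

definition alpha_set :: "real \<Rightarrow> real \<Rightarrow> (real \<Rightarrow> real) \<Rightarrow> (real \<Rightarrow> real) \<Rightarrow> real set" where
  "alpha_set p q F G =
     {\<alpha>\<in>{0<..<1}. \<exists>\<beta>\<in>{0<..<1}. q * \<alpha> + (1 - q) * \<beta> = p \<and> quantile F \<alpha> \<ge> quantile G \<beta>}"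

text \<open>The set can be empty, for instance if \<open>X \<le> 0\<close> and \<open>Y \<ge> 1\<close>. The infimum is taken inside
  the interval of those \<open>\<alpha>\<close> for which both \<open>\<alpha>\<close> and \<open>(p - q * \<alpha>) / (1 - q)\<close> lie in \<open>[0,1]\<close>; the
  infimum of the empty set is then the largest element \<open>min 1 (p / q)\<close> of that interval.\<close>

definition alpha_star :: "real \<Rightarrow> real \<Rightarrow> (real \<Rightarrow> real) \<Rightarrow> (real \<Rightarrow> real) \<Rightarrow> real" where
  "alpha_star p q F G =
     (if alpha_set p q F G = {} then min 1 (p / q) else Inf (alpha_set p q F G))"

definition cont_strict :: "(real \<Rightarrow> real) \<Rightarrow> real \<Rightarrow> bool" where
  "cont_strict H s \<longleftrightarrow> isCont H s \<and> (\<forall>z<s. H z < H s)"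

definition cont_flat :: "(real \<Rightarrow> real) \<Rightarrow> real \<Rightarrow> bool" where
  "cont_flat H s \<longleftrightarrow> isCont H s \<and> (\<exists>z<s. H z = H s)"

definition jump_strict :: "(real \<Rightarrow> real) \<Rightarrow> real \<Rightarrow> bool" where
  "jump_strict H s \<longleftrightarrow> \<not> isCont H s \<and> (\<forall>z<s. H z < left_limit H s)"

definition jump_flat :: "(real \<Rightarrow> real) \<Rightarrow> real \<Rightarrow> bool" where
  "jump_flat H s \<longleftrightarrow> \<not> isCont H s \<and> (\<exists>z<s. H z = left_limit H s)"

end

theory Submission
  imports Defs
begin

text \<open>Write \<open>F\<^sup>-\<close> for the left limit of \<open>F\<close> at \<open>s = s\<^sub>p\<close>. The mixture satisfies
  \<open>q F + (1 - q) G \<ge> p\<close> at \<open>s\<close> and \<open>< p\<close> to the left of \<open>s\<close>. A comparison of the levels with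
  \<open>F\<^sup>-\<close> and \<open>G(s)\<close> then gives \<open>\<alpha>\<^sub>* = max F\<^sup>- ((p - (1 - q) G(s)) / q)\<close>. Since
  \<open>F\<^sup>- \<le> \<alpha>\<^sub>* \<le> F(s)\<close>, the quantile of \<open>F\<close> at \<open>\<alpha>\<^sub>*\<close> is at most \<open>s\<close>, and it is smaller than \<open>s\<close>
  exactly when \<open>\<alpha>\<^sub>* = F\<^sup>-\<close> and \<open>F\<close> attains \<open>F\<^sup>-\<close> to the left of \<open>s\<close>; likewise for \<open>G\<close>. All
  sixteen cases are read off from this.\<close>

section \<open>Quantiles and left limits of one distribution function\<close>

context real_distribution
begin

text \<open>Right continuity makes the infimum attained: the level is reached at every point above
  \<open>x\<close>, and this passes to \<open>x\<close> in the limit. The level \<open>u\<close> is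
  arbitrary, which matters because \<alpha> and \<beta> may be 0 or 1.\<close>

lemma quantile_cdf_le_iff: "quantile (cdf M) u \<le> ereal x \<longleftrightarrow> u \<le> cdf M x"
proof
  assume le: "quantile (cdf M) u \<le> ereal x"
  have "u \<le> cdf M y" if "x < y" for y
  proof -
    have "quantile (cdf M) u < ereal y"
      using le that by (metis ereal_less_le less_ereal.simps(1) order_le_less_trans)
    then obtain z where "u \<le> cdf M z" "z < y"
      by (auto simp: quantile_def INF_less_iff)
    then show ?thesis
      using cdf_nondecreasing[of z y] by simp
  qed
  then have "\<forall>\<^sub>F y in at_right x. u \<le> cdf M y"
    by (auto simp: eventually_at_right_field intro: exI[of _ "x + 1"])
  moreover have "(cdf M \<longlongrightarrow> cdf M x) (at_right x)"
    using cdf_is_right_cont[of x] by (simp add: continuous_within)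
  ultimately show "u \<le> cdf M x"
    by (intro tendsto_lowerbound[where f = "cdf M"]) auto
qed (auto simp: quantile_def intro: INF_lower)

lemma quantile_cdf_less_iff: "quantile (cdf M) u < ereal x \<longleftrightarrow> (\<exists>z<x. u \<le> cdf M z)"
  by (auto simp: quantile_def INF_less_iff)

lemma left_limit_cdf: "left_limit (cdf M) x = measure M {..<x}"
  unfolding left_limit_def by (intro tendsto_Lim cdf_at_left) simp

lemma cdf_le_left_limit: "z < x \<Longrightarrow> cdf M z \<le> left_limit (cdf M) x"
  unfolding left_limit_cdf unfolding cdf_def by (intro finite_measure_mono) auto

lemma left_limit_le_cdf: "left_limit (cdf M) x \<le> cdf M x"
  unfolding left_limit_cdf unfolding cdf_def by (intro finite_measure_mono) auto

lemma left_limit_cdf_nonneg: "0 \<le> left_limit (cdf M) x"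
  by (simp add: left_limit_cdf)

text \<open>The jump at \<open>x\<close> is the mass of the point \<open>x\<close>.\<close>

lemma isCont_cdf_iff: "isCont (cdf M) x \<longleftrightarrow> left_limit (cdf M) x = cdf M x"
proof -
  have "{..x} = {..<x} \<union> {x}"
    by auto
  then have "cdf M x = measure M {..<x} + measure M {x}"
    unfolding cdf_def by (simp only:, intro finite_measure_Union) auto
  then show ?thesis
    by (simp add: isCont_cdf left_limit_cdf)
qed

text \<open>A point \<open>z < x\<close> reaching the level satisfies
  \<open>u \<le> cdf M z \<le> left_limit (cdf M) x \<le> u\<close>, so all of these agree. Every
  comparison of a quantile with \<open>s\<close> reduces to this.\<close>

lemma quantile_cdf_left_limit:
  assumes "left_limit (cdf M) x \<le> u" "u \<le> cdf M x"
  shows "quantile (cdf M) u < ereal x \<longleftrightarrow>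
      u = left_limit (cdf M) x \<and> (\<exists>z<x. cdf M z = left_limit (cdf M) x)"
    and "quantile (cdf M) u = ereal x \<longleftrightarrow>
      \<not> (u = left_limit (cdf M) x \<and> (\<exists>z<x. cdf M z = left_limit (cdf M) x))"
proof -
  show less: "quantile (cdf M) u < ereal x \<longleftrightarrow>
      u = left_limit (cdf M) x \<and> (\<exists>z<x. cdf M z = left_limit (cdf M) x)"
    using assms cdf_le_left_limit by (force simp: quantile_cdf_less_iff)
  have "quantile (cdf M) u \<le> ereal x"
    using assms by (simp add: quantile_cdf_le_iff)
  with less show "quantile (cdf M) u = ereal x \<longleftrightarrow>
      \<not> (u = left_limit (cdf M) x \<and> (\<exists>z<x. cdf M z = left_limit (cdf M) x))"
    by (metis order_le_less order_less_irrefl)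
qed

text \<open>The limits 0 and 1 at the two ends exclude both infinite values.\<close>

lemma quantile_cdf_eq_ereal:
  assumes "0 < u" "u < 1"
  shows "quantile (cdf M) u = ereal (real_of_ereal (quantile (cdf M) u))"
proof -
  obtain x where "u < cdf M x"
    using order_tendstoD(1)[OF cdf_lim_at_top_prob \<open>u < 1\<close>] eventually_happens'[of at_top]
    by (metis trivial_limit_at_top_linorder)
  then have "quantile (cdf M) u \<noteq> \<infinity>"
    using quantile_cdf_le_iff[of u x] by auto
  moreover obtain y where "cdf M y < u"
    using order_tendstoD(2)[OF cdf_lim_at_bot \<open>0 < u\<close>] eventually_happens'[of at_bot]
    by (metis trivial_limit_at_bot_linorder)
  then have "quantile (cdf M) u \<noteq> - \<infinity>"
    using quantile_cdf_le_iff[of u y] by auto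
  ultimately show ?thesis
    by (auto simp: ereal_real)
qed

text \<open>Values left of \<open>x\<close> never exceed the left limit, so staying strictly below
  it is the negation of attaining it. The four cases thus combine two yes-no questions: is there a
  jump, and is the left limit attained before \<open>x\<close>.\<close>

lemma case_predicates_cdf:
  "cont_strict (cdf M) x \<longleftrightarrow>
    left_limit (cdf M) x = cdf M x \<and> \<not> (\<exists>z<x. cdf M z = left_limit (cdf M) x)"
  "cont_flat (cdf M) x \<longleftrightarrow>
    left_limit (cdf M) x = cdf M x \<and> (\<exists>z<x. cdf M z = left_limit (cdf M) x)"
  "jump_strict (cdf M) x \<longleftrightarrow>
    left_limit (cdf M) x \<noteq> cdf M x \<and> \<not> (\<exists>z<x. cdf M z = left_limit (cdf M) x)"
  "jump_flat (cdf M) x \<longleftrightarrow>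
    left_limit (cdf M) x \<noteq> cdf M x \<and> (\<exists>z<x. cdf M z = left_limit (cdf M) x)"
proof -
  have "(\<forall>z<x. cdf M z < left_limit (cdf M) x) \<longleftrightarrow>
      \<not> (\<exists>z<x. cdf M z = left_limit (cdf M) x)"
    using cdf_le_left_limit by (metis order_le_less order_less_irrefl)
  then show
    "cont_strict (cdf M) x \<longleftrightarrow>
      left_limit (cdf M) x = cdf M x \<and> \<not> (\<exists>z<x. cdf M z = left_limit (cdf M) x)"
    "cont_flat (cdf M) x \<longleftrightarrow>
      left_limit (cdf M) x = cdf M x \<and> (\<exists>z<x. cdf M z = left_limit (cdf M) x)"
    "jump_strict (cdf M) x \<longleftrightarrow>
      left_limit (cdf M) x \<noteq> cdf M x \<and> \<not> (\<exists>z<x. cdf M z = left_limit (cdf M) x)"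
    "jump_flat (cdf M) x \<longleftrightarrow>
      left_limit (cdf M) x \<noteq> cdf M x \<and> (\<exists>z<x. cdf M z = left_limit (cdf M) x)"
    by (auto simp: cont_strict_def cont_flat_def jump_strict_def jump_flat_def isCont_cdf_iff)
qed

end

section \<open>The distribution function of the mixture\<close>

lemma (in prob_space) cdf_bernoulli_mixture:
  fixes I X Y :: "'a \<Rightarrow> real"
  assumes [measurable]: "X \<in> borel_measurable M" "Y \<in> borel_measurable M"
      "I \<in> borel_measurable M"
    and q: "0 \<le> q" "q \<le> 1"
    and I: "distr M borel I = distr (measure_pmf (bernoulli_pmf q)) borel of_bool"
    and XI: "indep_var borel X borel I" and YI: "indep_var borel Y borel I"
  shows "cdf (distr M borel (\<lambda>\<omega>. I \<omega> * X \<omega> + (1 - I \<omega>) * Y \<omega>)) x =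
      q * cdf (distr M borel X) x + (1 - q) * cdf (distr M borel Y) x"
proof -
  have measure_I: "prob (I -` B \<inter> space M) = measure_pmf.prob (bernoulli_pmf q) (of_bool -` B)"
    if [measurable]: "B \<in> sets borel" for B :: "real set"
    using arg_cong[OF I, of "\<lambda>N. measure N B"] by (simp add: measure_distr)
  have "of_bool -` {1::real} = {True}" "of_bool -` {0::real} = {False}"
    by (auto simp: of_bool_def split: if_splits)
  then have I1: "prob (I -` {1} \<inter> space M) = q" and I0: "prob (I -` {0} \<inter> space M) = 1 - q"
    using q by (simp_all add: measure_I measure_pmf_single)
  \<comment> \<open>\<open>I\<close> is real-valued and only its law is given, so its values are 0
    or 1 merely almost surely.\<close>
  have "of_bool -` {0, 1::real} = UNIV"
    by (auto simp: of_bool_def)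
  then have "prob (I -` {0, 1} \<inter> space M) = 1"
    by (simp add: measure_I)
  then have "AE \<omega> in M. \<omega> \<in> I -` {0, 1} \<inter> space M"
    by (subst (asm) prob_eq_1) auto
  then have I01: "AE \<omega> in M. I \<omega> = 0 \<or> I \<omega> = 1"
    by eventually_elim auto
  have prodX: "prob ((\<lambda>\<omega>. (X \<omega>, I \<omega>)) -` ({..x} \<times> {1}) \<inter> space M) =
      prob (X -` {..x} \<inter> space M) * prob (I -` {1} \<inter> space M)"
    by (rule indep_varD[OF XI]) auto
  have prodY: "prob ((\<lambda>\<omega>. (Y \<omega>, I \<omega>)) -` ({..x} \<times> {0}) \<inter> space M) =
      prob (Y -` {..x} \<inter> space M) * prob (I -` {0} \<inter> space M)"
    by (rule indep_varD[OF YI]) auto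
  let ?A = "(\<lambda>\<omega>. (X \<omega>, I \<omega>)) -` ({..x} \<times> {1}) \<inter> space M"
  let ?B = "(\<lambda>\<omega>. (Y \<omega>, I \<omega>)) -` ({..x} \<times> {0}) \<inter> space M"
  have A: "?A = {\<omega>\<in>space M. X \<omega> \<le> x \<and> I \<omega> = 1}" and B: "?B = {\<omega>\<in>space M. Y \<omega> \<le> x \<and> I \<omega> = 0}"
    by auto
  have [measurable]: "?A \<in> sets M" "?B \<in> sets M"
    unfolding A B by measurable
  \<comment> \<open>The sum is \<open>X\<close> where \<open>I\<close> is 1 and \<open>Y\<close>
    where \<open>I\<close> is 0; the two events are disjoint and each factors by
    independence.\<close>
  have "prob ((\<lambda>\<omega>. I \<omega> * X \<omega> + (1 - I \<omega>) * Y \<omega>) -` {..x} \<inter> space M) = prob (?A \<union> ?B)"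
  proof (rule finite_measure_eq_AE)
    show "AE \<omega> in M. (\<omega> \<in> (\<lambda>\<omega>. I \<omega> * X \<omega> + (1 - I \<omega>) * Y \<omega>) -` {..x} \<inter> space M) =
        (\<omega> \<in> ?A \<union> ?B)"
      using I01 by eventually_elim auto
  qed measurable
  also have "\<dots> = prob ?A + prob ?B"
    by (intro finite_measure_Union) auto
  finally show ?thesis
    unfolding prodX prodY I1 I0 by (simp add: cdf_def measure_distr mult.commute)
qed

section \<open>A closed form for the optimal level\<close>

text \<open>The claimed value is a lower bound of the admissible levels, and every larger level
  below \<open>min 1 (p / q)\<close> is admissible because \<open>s\<close> then separates the two
  quantiles.\<close>

lemma alpha_star_cdf_eq:
  fixes p q s :: real
  assumes "real_distribution M" "real_distribution N"
    and q: "0 < q" "q < 1"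
    and ge: "p \<le> q * cdf M s + (1 - q) * cdf N s"
    and less: "\<And>z. z < s \<Longrightarrow> q * cdf M z + (1 - q) * cdf N z < p"
    and lim: "q * left_limit (cdf M) s + (1 - q) * left_limit (cdf N) s \<le> p"
  shows "alpha_star p q (cdf M) (cdf N) =
      max (left_limit (cdf M) s) ((p - (1 - q) * cdf N s) / q)" (is "_ = ?m")
proof -
  interpret M: real_distribution M by fact
  interpret N: real_distribution N by fact
  let ?A = "alpha_set p q (cdf M) (cdf N)"
  let ?L = "max 0 ((p - (1 - q)) / q)"
  let ?U = "min 1 (p / q)"
  \<comment> \<open>The equation determines \<beta>; \<open>?L\<close> and \<open>?U\<close> express
    that both levels lie strictly between 0 and 1.\<close>
  have mem: "a \<in> ?A \<longleftrightarrow> ?L < a \<and> a < ?U \<and>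
      quantile (cdf N) ((p - q * a) / (1 - q)) \<le> quantile (cdf M) a" for a
  proof -
    have "q * a + (1 - q) * b = p \<longleftrightarrow> b = (p - q * a) / (1 - q)" for b
      using q by (auto simp: field_simps)
    moreover have "0 < (p - q * a) / (1 - q) \<longleftrightarrow> a < p / q"
      "(p - q * a) / (1 - q) < 1 \<longleftrightarrow> (p - (1 - q)) / q < a"
      using q by (auto simp: field_simps)
    ultimately show ?thesis
      by (auto simp: alpha_set_def)
  qed
  have lower: "?m \<le> a" if "a \<in> ?A" for a
  proof -
    let ?b = "(p - q * a) / (1 - q)"
    have quant: "quantile (cdf N) ?b \<le> quantile (cdf M) a"
      using that mem by blast
    have trans: "?b \<le> cdf N z" if "a \<le> cdf M z" for z
      using that quant by (meson M.quantile_cdf_le_iff N.quantile_cdf_le_iff order_trans)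
    \<comment> \<open>Otherwise both components reach their levels at \<open>z\<close>, and the
      mixture reaches \<open>p\<close> before \<open>s\<close>.\<close>
    have below: "cdf M z \<le> a" if "z < s" for z
    proof (rule ccontr)
      assume "\<not> cdf M z \<le> a"
      then have "q * a \<le> q * cdf M z" and "p - q * a \<le> (1 - q) * cdf N z"
        using q trans[of z] by (auto simp: pos_divide_le_eq mult.commute)
      then have "p \<le> q * cdf M z + (1 - q) * cdf N z"
        by simp
      then show False
        using less[OF that] by simp
    qed
    have "\<forall>\<^sub>F z in at_left s. cdf M z \<le> a"
      using below by (auto simp: eventually_at_left_field intro: exI[of _ "s - 1"])
    then have "left_limit (cdf M) s \<le> a"
      unfolding M.left_limit_cdf by (intro tendsto_upperbound[OF M.cdf_at_left]) auto
    moreover have "?b \<le> cdf N s"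
    \<comment> \<open>If the first component misses its level at \<open>s\<close>, then
      \<open>ge\<close> forces the second to make up for it.\<close>
    proof (cases "a \<le> cdf M s")
      case False
      then have "q * cdf M s \<le> q * a"
        using q by simp
      with ge have "p - q * a \<le> (1 - q) * cdf N s"
        by simp
      with q show ?thesis
        by (simp add: pos_divide_le_eq mult.commute)
    qed (rule trans)
    then have "(p - (1 - q) * cdf N s) / q \<le> a"
      using q by (auto simp: field_simps)
    ultimately show ?thesis
      by simp
  qed
  have "(1 - q) * cdf N s \<le> 1 - q"
    using N.cdf_bounded_prob[of s] q mult_left_le[of "cdf N s" "1 - q"] by simp
  then have "(p - (1 - q)) / q \<le> (p - (1 - q) * cdf N s) / q"
    using q by (intro divide_right_mono) linarith+
  then have L_le: "?L \<le> ?m"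
    using M.left_limit_cdf_nonneg[of s] by linarith
  \<comment> \<open>The second entry of \<open>?m\<close> keeps the quantile of \<open>N\<close> at
    most \<open>s\<close>; the first keeps that of \<open>M\<close> at least
    \<open>s\<close>.\<close>
  have upper: "a \<in> ?A" if "?m < a" "a < ?U" for a
  proof -
    have "(p - q * a) / (1 - q) \<le> cdf N s"
      using that q by (auto simp: field_simps)
    then have "quantile (cdf N) ((p - q * a) / (1 - q)) \<le> ereal s"
      by (simp add: N.quantile_cdf_le_iff)
    moreover have "\<not> quantile (cdf M) a < ereal s"
      using that M.cdf_le_left_limit by (force simp: M.quantile_cdf_less_iff)
    ultimately show ?thesis
      using that L_le unfolding mem by force
  qed
  \<comment> \<open>For \<open>m_le\<close>, each entry of the maximum \<open>?m\<close> is compared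
    with each entry of the minimum \<open>?U\<close>.\<close>
  have "q * left_limit (cdf M) s \<le> p"
    using lim q N.left_limit_cdf_nonneg[of s] by (smt (verit) mult_nonneg_nonneg)
  then have "left_limit (cdf M) s \<le> p / q"
    using q by (simp add: field_simps)
  moreover have "left_limit (cdf M) s \<le> 1"
    using M.left_limit_le_cdf[of s] M.cdf_bounded_prob[of s] by simp
  moreover have "(p - (1 - q) * cdf N s) / q \<le> cdf M s"
    using ge q by (auto simp: field_simps)
  then have "(p - (1 - q) * cdf N s) / q \<le> 1"
    using M.cdf_bounded_prob[of s] by simp
  moreover have "(p - (1 - q) * cdf N s) / q \<le> p / q"
    using q N.cdf_nonneg[of s] by (simp add: divide_right_mono)
  ultimately have m_le: "?m \<le> ?U"
    by simp
  show ?thesis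
  proof (cases "?m = ?U")
    \<comment> \<open>Admissible levels are at least \<open>?m\<close> and strictly below
      \<open>?U\<close>, so there are none; the default value in \<open>alpha_star\<close> is
      exactly \<open>?U\<close>.\<close>
    case True
    then have "?A = {}"
      using lower mem by force
    with True show ?thesis
      by (simp add: alpha_star_def)
  next
    case False
    with m_le have m_less: "?m < ?U"
      by linarith
    then obtain a where "?m < a" "a < ?U"
      using dense by blast
    from upper[OF this] have ne: "?A \<noteq> {}"
      by auto
    have "Inf ?A = ?m"
    proof (rule cInf_eq_non_empty[OF ne lower])
      fix y assume y: "\<And>a. a \<in> ?A \<Longrightarrow> y \<le> a"
      show "y \<le> ?m"
        using upper y by (intro dense_ge_bounded[OF m_less]) auto
    qed
    with ne show ?thesis
      by (simp add: alpha_star_def)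
  qed
qed

section \<open>The sixteen cases\<close>

text \<open>As \<alpha> is minimal, the excess of \<open>p\<close> over
  \<open>left_limit FS s\<close> is charged to the jump of \<open>G\<close> first; the jump of
  \<open>F\<close> is used only once \<open>p\<close> exceeds
  \<open>q * left_limit F s + (1 - q) * G s\<close>. This threshold therefore decides the cases in
  which \<open>F\<close> jumps off a flat stretch and \<open>G\<close> jumps too. Both can jump off
  flat stretches: two point masses at 0 give \<open>s = 0\<close> for every \<open>p\<close>. At a
  jump of \<open>F\<close>, \<alpha> is only confined between the left limit and
  \<open>F s\<close>.\<close>

theorem theorem1:
  fixes M :: "'a measure"
    and I X Y S :: "'a \<Rightarrow> real"
    and p q s \<alpha> \<beta> :: real
    and F G FS :: "real \<Rightarrow> real"
  assumes "prob_space M"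
    and "X \<in> borel_measurable M"
    and "Y \<in> borel_measurable M"
    and "I \<in> borel_measurable M"
    and "0 < q" "q < 1"
    and "distr M borel I = distr (measure_pmf (bernoulli_pmf q)) borel of_bool"
    and "prob_space.indep_var M borel X borel I"
    and "prob_space.indep_var M borel Y borel I"
    and "S = (\<lambda>\<omega>. I \<omega> * X \<omega> + (1 - I \<omega>) * Y \<omega>)"
    and "F = cdf (distr M borel X)"
    and "G = cdf (distr M borel Y)"
    and "FS = cdf (distr M borel S)"
    and "0 < p" "p < 1"
    and "s = real_of_ereal (quantile FS p)"
    and "\<alpha> = alpha_star p q F G"
    and "\<beta> = (p - q * \<alpha>) / (1 - q)"
  shows "0 \<le> \<alpha> \<and> \<alpha> \<le> 1 \<and> 0 \<le> \<beta> \<and> \<beta> \<le> 1 \<and>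
     quantile FS p = ereal s \<and>
     ereal s = max (quantile F \<alpha>) (quantile G \<beta>) \<and>
     (cont_strict F s \<and> cont_strict G s \<longrightarrow>
        \<alpha> = F s \<and>
        \<beta> = G s \<and>
        ereal s = quantile F \<alpha> \<and> quantile F \<alpha> = quantile G \<beta>) \<and>
     (cont_strict F s \<and> cont_flat G s \<longrightarrow>
        \<alpha> = F s \<and>
        \<beta> = G s \<and>
        ereal s = quantile F \<alpha> \<and> quantile F \<alpha> > quantile G \<beta>) \<and>
     (cont_strict F s \<and> jump_strict G s \<longrightarrow>
        \<alpha> = F s \<and>
        ereal s = quantile F \<alpha> \<and> quantile F \<alpha> = quantile G \<beta>) \<and>
     (cont_strict F s \<and> jump_flat G s \<longrightarrow>
        \<alpha> = F s \<and>
        (left_limit FS s < p \<longrightarrow> ereal s = quantile F \<alpha> \<and> quantile F \<alpha> = quantile G \<beta>) \<and>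
        (left_limit FS s = p \<longrightarrow> ereal s = quantile F \<alpha> \<and> quantile F \<alpha> > quantile G \<beta>)) \<and>
     (cont_flat F s \<and> cont_strict G s \<longrightarrow>
        \<alpha> = F s \<and>
        \<beta> = G s \<and>
        ereal s = quantile G \<beta> \<and> quantile G \<beta> > quantile F \<alpha>) \<and>
     \<not> (cont_flat F s \<and> cont_flat G s) \<and>
     (cont_flat F s \<and> jump_strict G s \<longrightarrow>
        \<alpha> = F s \<and>
        ereal s = quantile G \<beta> \<and> quantile G \<beta> > quantile F \<alpha>) \<and>
     (cont_flat F s \<and> jump_flat G s \<longrightarrow>
        \<alpha> = F s \<and>
        ereal s = quantile G \<beta> \<and> quantile G \<beta> > quantile F \<alpha>) \<and>
     (jump_strict F s \<and> cont_strict G s \<longrightarrow>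
        \<beta> = G s \<and>
        ereal s = quantile F \<alpha> \<and> quantile F \<alpha> = quantile G \<beta>) \<and>
     (jump_strict F s \<and> cont_flat G s \<longrightarrow>
        \<beta> = G s \<and>
        ereal s = quantile F \<alpha> \<and> quantile F \<alpha> > quantile G \<beta>) \<and>
     (jump_strict F s \<and> jump_strict G s \<longrightarrow>
        ereal s = quantile F \<alpha> \<and> quantile F \<alpha> = quantile G \<beta>) \<and>
     (jump_strict F s \<and> jump_flat G s \<longrightarrow>
        (left_limit FS s < p \<longrightarrow> ereal s = quantile F \<alpha> \<and> quantile F \<alpha> = quantile G \<beta>) \<and>
        (left_limit FS s = p \<longrightarrow> ereal s = quantile F \<alpha> \<and> quantile F \<alpha> > quantile G \<beta>)) \<and>
     (jump_flat F s \<and> cont_strict G s \<longrightarrow>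
        \<beta> = G s \<and>
        (left_limit FS s < p \<longrightarrow> ereal s = quantile F \<alpha> \<and> quantile F \<alpha> = quantile G \<beta>) \<and>
        (left_limit FS s = p \<longrightarrow> ereal s = quantile G \<beta> \<and> quantile G \<beta> > quantile F \<alpha>)) \<and>
     (jump_flat F s \<and> cont_flat G s \<longrightarrow>
        \<beta> = G s \<and>
        ereal s = quantile F \<alpha> \<and> quantile F \<alpha> > quantile G \<beta>) \<and>
     (jump_flat F s \<and> jump_strict G s \<longrightarrow>
        (q * left_limit F s + (1 - q) * G s < p \<longrightarrow> ereal s = quantile F \<alpha> \<and> quantile F \<alpha> = quantile G \<beta>) \<and>
        (left_limit FS s < p \<and> p \<le> q * left_limit F s + (1 - q) * G s \<longrightarrow> ereal s = quantile G \<beta> \<and> quantile G \<beta> > quantile F \<alpha>) \<and>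
        (left_limit FS s = p \<longrightarrow> ereal s = quantile G \<beta> \<and> quantile G \<beta> > quantile F \<alpha>)) \<and>
     (jump_flat F s \<and> jump_flat G s \<longrightarrow>
        left_limit FS s < p \<and>
        (q * left_limit F s + (1 - q) * G s < p \<longrightarrow> ereal s = quantile F \<alpha> \<and> quantile F \<alpha> = quantile G \<beta>) \<and>
        (p \<le> q * left_limit F s + (1 - q) * G s \<longrightarrow> ereal s = quantile G \<beta> \<and> quantile G \<beta> > quantile F \<alpha>)) \<and>
     \<beta> = (p - q * \<alpha>) / (1 - q) \<and> \<beta> \<le> G s \<and>
     \<alpha> = (p - (1 - q) * \<beta>) / q \<and> left_limit F s \<le> \<alpha> \<and> \<alpha> \<le> F s"
proof -
  interpret prob_space M by fact
  note [measurable] = assms(2-4)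
  have S_measurable [measurable]: "S \<in> borel_measurable M"
    unfolding assms(10) by measurable
  interpret F: real_distribution "distr M borel X" by (rule real_distribution_distr) fact
  interpret G: real_distribution "distr M borel Y" by (rule real_distribution_distr) fact
  interpret FS: real_distribution "distr M borel S" by (rule real_distribution_distr) fact
  note q = \<open>0 < q\<close> \<open>q < 1\<close> and p = \<open>0 < p\<close> \<open>p < 1\<close>
  note F = \<open>F = cdf (distr M borel X)\<close> and G = \<open>G = cdf (distr M borel Y)\<close>
    and FS = \<open>FS = cdf (distr M borel S)\<close>
  have mix: "FS x = q * F x + (1 - q) * G x" for x
    unfolding F G FS assms(10) using q assms by (intro cdf_bernoulli_mixture) auto
  have s: "quantile FS p = ereal s"
    using FS.quantile_cdf_eq_ereal[OF p] FS assms(16) by simp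
  have FS_ge: "p \<le> FS s"
    using FS.quantile_cdf_le_iff[of p s] s FS by simp
  have FS_less: "FS z < p" if "z < s" for z
    using FS.quantile_cdf_le_iff[of p z] s FS that by simp
  let ?Fm = "left_limit F s" and ?Gm = "left_limit G s"
  have mix_lim: "left_limit FS s = q * ?Fm + (1 - q) * ?Gm"
  proof -
    have "((\<lambda>x. q * F x + (1 - q) * G x) \<longlongrightarrow> q * ?Fm + (1 - q) * ?Gm) (at_left s)"
      unfolding F G F.left_limit_cdf G.left_limit_cdf
      by (intro tendsto_intros F.cdf_at_left G.cdf_at_left)
    moreover have "FS = (\<lambda>x. q * F x + (1 - q) * G x)"
      using mix by blast
    ultimately show ?thesis
      unfolding left_limit_def[of FS] by (intro tendsto_Lim) auto
  qed
  have "\<forall>\<^sub>F z in at_left s. FS z \<le> p"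
    using FS_less by (auto simp: eventually_at_left_field less_imp_le intro!: exI[of _ "s - 1"])
  then have lim_le: "left_limit FS s \<le> p"
    unfolding FS FS.left_limit_cdf by (intro tendsto_upperbound[OF FS.cdf_at_left]) auto
  have \<alpha>: "\<alpha> = max ?Fm ((p - (1 - q) * G s) / q)"
    unfolding assms(17) F G
    by (rule alpha_star_cdf_eq)
      (use q FS_ge FS_less lim_le in
        \<open>auto simp: mix mix_lim F[symmetric] G[symmetric] F.real_distribution_axioms
          G.real_distribution_axioms\<close>)
  have sum: "q * \<alpha> + (1 - q) * \<beta> = p"
    using q assms(18) by simp
  \<comment> \<open>Subtracting from \<open>p\<close> turns the maximum into a minimum, which gives
    the dual formula for \<beta>.\<close>
  have "q * \<alpha> = max (q * ?Fm) (p - (1 - q) * G s)"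
    using q by (simp add: \<alpha> max_mult_distrib_left)
  then have "p - q * \<alpha> = min (p - q * ?Fm) ((1 - q) * G s)"
    by auto
  then have \<beta>: "\<beta> = min ((p - q * ?Fm) / (1 - q)) (G s)"
    using q by (simp add: assms(18) min_divide_distrib_right)
  have F_bounds: "0 \<le> ?Fm" "F s \<le> 1" and G_bounds: "0 \<le> ?Gm" "G s \<le> 1"
    and Fm_le: "?Fm \<le> F s" and Gm_le: "?Gm \<le> G s"
    using F.left_limit_cdf_nonneg G.left_limit_cdf_nonneg F.cdf_bounded_prob G.cdf_bounded_prob
      F.left_limit_le_cdf G.left_limit_le_cdf by (auto simp: F G)
  have "(p - (1 - q) * G s) / q \<le> F s"
    using FS_ge q by (auto simp: mix field_simps)
  then have \<alpha>_bounds: "?Fm \<le> \<alpha>" "\<alpha> \<le> F s"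
    using Fm_le by (auto simp: \<alpha>)
  have "?Gm \<le> (p - q * ?Fm) / (1 - q)"
    using lim_le q by (auto simp: mix_lim field_simps)
  then have \<beta>_bounds: "?Gm \<le> \<beta>" "\<beta> \<le> G s"
    using Gm_le by (auto simp: \<beta>)
  define flatF where "flatF \<longleftrightarrow> (\<exists>z<s. F z = ?Fm)"
  define flatG where "flatG \<longleftrightarrow> (\<exists>z<s. G z = ?Gm)"
  have quantF: "quantile F \<alpha> < ereal s \<longleftrightarrow> \<alpha> = ?Fm \<and> flatF"
      "quantile F \<alpha> = ereal s \<longleftrightarrow> \<not> (\<alpha> = ?Fm \<and> flatF)"
    and quantG: "quantile G \<beta> < ereal s \<longleftrightarrow> \<beta> = ?Gm \<and> flatG"
      "quantile G \<beta> = ereal s \<longleftrightarrow> \<not> (\<beta> = ?Gm \<and> flatG)"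
    using \<alpha>_bounds \<beta>_bounds F.quantile_cdf_left_limit[of s \<alpha>]
      G.quantile_cdf_left_limit[of s \<beta>]
    unfolding F G flatF_def flatG_def by blast+
  have cases:
    "cont_strict F s \<longleftrightarrow> ?Fm = F s \<and> \<not> flatF" "cont_flat F s \<longleftrightarrow> ?Fm = F s \<and> flatF"
    "jump_strict F s \<longleftrightarrow> ?Fm \<noteq> F s \<and> \<not> flatF" "jump_flat F s \<longleftrightarrow> ?Fm \<noteq> F s \<and> flatF"
    "cont_strict G s \<longleftrightarrow> ?Gm = G s \<and> \<not> flatG" "cont_flat G s \<longleftrightarrow> ?Gm = G s \<and> flatG"
    "jump_strict G s \<longleftrightarrow> ?Gm \<noteq> G s \<and> \<not> flatG" "jump_flat G s \<longleftrightarrow> ?Gm \<noteq> G s \<and> flatG"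
    unfolding F G flatF_def flatG_def by (fact F.case_predicates_cdf G.case_predicates_cdf)+
  have \<alpha>_eq: "\<alpha> = ?Fm \<longleftrightarrow> p \<le> q * ?Fm + (1 - q) * G s"
  proof -
    have "(p - (1 - q) * G s) / q \<le> ?Fm \<longleftrightarrow> p \<le> q * ?Fm + (1 - q) * G s"
      using q by (auto simp: field_simps)
    then show ?thesis
      by (auto simp: \<alpha> max_def)
  qed
  have "(p - q * ?Fm) / (1 - q) = ?Gm \<longleftrightarrow> left_limit FS s = p"
    using q by (auto simp: mix_lim divide_eq_eq mult.commute)
  \<comment> \<open>Either no excess is left to distribute, or \<open>G\<close> has no jump to take
    it.\<close>
  then have \<beta>_eq: "\<beta> = ?Gm \<longleftrightarrow> left_limit FS s = p \<or> ?Gm = G s"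
    using \<open>?Gm \<le> (p - q * ?Fm) / (1 - q)\<close> Gm_le by (auto simp: \<beta> min_def)
  have lim_mono: "left_limit FS s \<le> q * ?Fm + (1 - q) * G s"
    using q Gm_le by (simp add: mix_lim mult_left_mono)
  \<comment> \<open>At the later of the two points where the left limits are attained, still before
    \<open>s\<close>, the mixture would already reach \<open>p\<close>.\<close>
  have not_both: False if "left_limit FS s = p" flatF flatG
  proof -
    obtain y z where yz: "y < s" "F y = ?Fm" "z < s" "G z = ?Gm"
      using \<open>flatF\<close> \<open>flatG\<close> unfolding flatF_def flatG_def by blast
    let ?x = "max y z"
    have "?Fm \<le> F ?x" "?Gm \<le> G ?x"
      using yz F.cdf_nondecreasing[of y ?x] G.cdf_nondecreasing[of z ?x] by (auto simp: F G)
    then have "left_limit FS s \<le> FS ?x"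
      unfolding mix_lim mix using q by (intro add_mono mult_left_mono) auto
    with that(1) FS_less[of ?x] yz show False
      by simp
  qed
  have both_eq: "left_limit FS s = p" if "\<alpha> = ?Fm" "\<beta> = ?Gm"
    using sum that by (simp add: mix_lim)
  have \<alpha>_cont: "\<alpha> = F s" if "?Fm = F s"
    using \<alpha>_bounds that by simp
  have \<beta>_cont: "\<beta> = G s" if "?Gm = G s"
    using \<beta>_bounds that by simp
  have \<alpha>_from_\<beta>: "\<alpha> = (p - (1 - q) * \<beta>) / q"
    using sum q by (simp add: field_simps)
  \<comment> \<open>If both quantiles were below \<open>s\<close>, both levels would be left limits
    attained earlier; \<open>both_eq\<close> and \<open>not_both\<close> exclude this.\<close>
  have quant_max: "ereal s = max (quantile F \<alpha>) (quantile G \<beta>)"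
    using quantF quantG not_both both_eq by (metis max.absorb3 max.absorb4 max.idem)
  have quant_less: "quantile F \<alpha> < quantile G \<beta> \<longleftrightarrow> \<alpha> = ?Fm \<and> flatF"
    "quantile G \<beta> < quantile F \<alpha> \<longleftrightarrow> \<beta> = ?Gm \<and> flatG"
    "quantile F \<alpha> = quantile G \<beta> \<longleftrightarrow> \<not> (\<alpha> = ?Fm \<and> flatF) \<and> \<not> (\<beta> = ?Gm \<and> flatG)"
    using quantF quantG not_both both_eq
    by (metis order_less_irrefl order_less_asym)+
  have less_p: "left_limit FS s < p \<longleftrightarrow> left_limit FS s \<noteq> p"
    using lim_le by auto
  have less_mix: "q * ?Fm + (1 - q) * G s < p \<longleftrightarrow> \<alpha> \<noteq> ?Fm"
      "p \<le> q * ?Fm + (1 - q) * G s \<longleftrightarrow> \<alpha> = ?Fm"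
    using \<alpha>_eq by auto
  have \<alpha>_lim: "\<alpha> = ?Fm" if "left_limit FS s = p"
    using lim_mono that \<alpha>_eq by simp
  \<comment> \<open>Continuity pins both levels to the left limits, so \<open>both_eq\<close>
    applies and (2b) cannot occur.\<close>
  have not_cont_flat: "\<not> (?Fm = F s \<and> flatF \<and> ?Gm = G s \<and> flatG)"
    using \<alpha>_cont \<beta>_cont both_eq not_both by metis
  have s_eq: "ereal s = quantile F \<alpha> \<longleftrightarrow> \<not> (\<alpha> = ?Fm \<and> flatF)"
      "ereal s = quantile G \<beta> \<longleftrightarrow> \<not> (\<beta> = ?Gm \<and> flatG)"
    using quantF quantG by metis+
  have bounds: "0 \<le> \<alpha>" "\<alpha> \<le> 1" "0 \<le> \<beta>" "\<beta> \<le> 1"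
    using \<alpha>_bounds \<beta>_bounds F_bounds G_bounds by simp_all
  show ?thesis
    \<comment> \<open>After unfolding, every case is a propositional statement about equalities of
      levels and left limits and about \<open>flatF\<close> and \<open>flatG\<close>.\<close>
    unfolding cases s_eq quant_less less_p less_mix
    using bounds s quant_max \<alpha>_bounds \<beta>_bounds \<alpha>_from_\<beta> assms(18) \<alpha>_cont \<beta>_cont \<beta>_eq \<alpha>_lim
      both_eq not_both not_cont_flat
    by (intro conjI impI) (assumption | metis)+
qed

end
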